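(* For every integer $N\ge1$, $$F_N(x)=\prod_{k=1}^{N}\frac{1}{1-x^k}=\sum_{k=1}^{N}\sum_{l=1}^{\lfloor N/k\rfloor}\frac{g_{k,l}^{(N)}(x)}{(1-x^k)^{l}},$$ where the polynomials $g_{k,l}^{(N)}(x)$ are as defined in the context.
   Context: For $r,s,a\in\mathbb{Q}[x]$ with $a$ non-constant and $\gcd(s,a)=1$, $\mathrm{eval}(r/s;a)$ denotes the remainder of $\alpha(x)r(x)$ upon division by $a(x)$, where $\alpha s\equiv1\pmod a$ (the unique polynomial of degree $<\deg a$ congruent to $rs^{-1}$ mod $a$). Convention: $\Phi_1(x)=1-x$, and $\Phi_n(x)$ for $n\ge2$ is the $n$-th cyclotomic polynomial, so $1-x^n=\prod_{d\mid n}\Phi_d(x)$. Let $\Theta_k(x)=(1-x^k)/\Phi_k(x)$. For $1\le k\le N$ set $$h_k^{(N)}(x)=\mathrm{eval}\Bigl(\frac{1}{\prod_{1\le i\le N,\ i\ne k}\Phi_i(x)^{\lfloor N/i\rfloor}};\ \Phi_k(x)^{\lfloor N/k\rfloor}\Bigr),\qquad g_k^{(N)}(x)=\Theta_k(x)^{\lfloor N/k\rfloor}h_k^{(N)}(x).$$ Let $D_k$ be the $\mathbb{Q}$-linear operator on $\mathbb{Q}[x]$ with $D_k(x^m)=\lfloor m/k\rfloor x^{m-k}$ (which is $0$ for $m<k$). For $0\le l\le\lfloor N/k\rfloor-1$ define $g_{k,\lfloor N/k\rfloor-l}^{(N)}(x)=\mathrm{eval}\bigl(\tfrac{(-1)^l}{l!}D_k^{\,l}g_k^{(N)}(x);\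 1-x^k\bigr)$, i.e. the remainder of $\tfrac{(-1)^l}{l!}D_k^{\,l}g_k^{(N)}(x)$ modulo $1-x^k$ ($D_k^0$ is the identity). *)

theory Defs
  imports
    "HOL-Computational_Algebra.Computational_Algebra"
    "HOL-Computational_Algebra.Field_as_Ring"
    "HOL-Number_Theory.Modular_Inverse"
begin

section \<open>Cyclotomic polynomials\<close>

definition primitive_roots_unity :: "nat \<Rightarrow> complex set" where
  "primitive_roots_unity n = {z. z ^ n = 1 \<and> (\<forall>m. 0 < m \<and> m < n \<longrightarrow> z ^ m \<noteq> 1)}"

text \<open>
  The product over the primitive \<open>n\<close>-th roots of unity has rational coefficients;
  existence and uniqueness of this preimage for \<open>n > 0\<close> is \<open>map_poly_cyclotomic\<close> below.
\<close>
definition cyclotomic :: "nat \<Rightarrow> rat poly" where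
  "cyclotomic n =
     (THE p. map_poly of_rat p = (\<Prod>z\<in>primitive_roots_unity n. [:- z, 1:]))"

lemma roots_unity_eq_Union_primitive:
  assumes "n > 0"
  shows "{z::complex. z ^ n = 1} = (\<Union>d\<in>{d. d dvd n}. primitive_roots_unity d)"
proof (intro equalityI subsetI)
  fix z :: complex assume "z \<in> {z. z ^ n = 1}"
  hence z: "z ^ n = 1" by simp
  define d where "d = (LEAST m. m > 0 \<and> z ^ m = 1)"
  have d: "d > 0 \<and> z ^ d = 1"
    unfolding d_def by (rule LeastI[of _ n]) (use assms z in auto)
  have least: "z ^ m \<noteq> 1" if "0 < m" "m < d" for m
    using not_less_Least[of m "\<lambda>m. m > 0 \<and> z ^ m = 1"] that by (auto simp: d_def)
  have "z ^ n = (z ^ d) ^ (n div d) * z ^ (n mod d)"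
    by (simp flip: power_mult power_add)
  hence "z ^ (n mod d) = 1" using z d by simp
  hence "n mod d = 0" using least[of "n mod d"] d by (metis gr0I mod_less_divisor)
  hence "d dvd n" by auto
  thus "z \<in> (\<Union>d\<in>{d. d dvd n}. primitive_roots_unity d)"
    using d least by (auto simp: primitive_roots_unity_def)
next
  fix z :: complex assume "z \<in> (\<Union>d\<in>{d. d dvd n}. primitive_roots_unity d)"
  thus "z \<in> {z. z ^ n = 1}"
    by (auto simp: primitive_roots_unity_def power_mult elim!: dvdE)
qed

lemma finite_primitive_roots_unity: "n > 0 \<Longrightarrow> finite (primitive_roots_unity n)"
  by (rule finite_subset[OF _ finite_roots_unity[of n]]) (auto simp: primitive_roots_unity_def)

lemma primitive_roots_unity_disjoint:
  "d > 0 \<Longrightarrow> e > 0 \<Longrightarrow> d \<noteq> e \<Longrightarrow> primitive_roots_unity d \<inter> primitive_roots_unity e = {}"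
  by (auto simp: primitive_roots_unity_def) (metis nat_neq_iff)

lemma prod_roots_unity:
  assumes "n > 0"
  shows "(\<Prod>z | z ^ n = 1. [:- z, 1:]) = monom 1 n - (1 :: complex poly)"
proof (rule ccontr)
  let ?A = "{z::complex. z ^ n = 1}"
  define P where "P = (\<Prod>z\<in>?A. [:- z, 1:])"
  define Q where "Q = monom 1 n - (1 :: complex poly)"
  assume "(\<Prod>z | z ^ n = 1. [:- z, 1:]) \<noteq> monom 1 n - (1 :: complex poly)"
  hence neq: "P - Q \<noteq> 0" by (simp add: P_def Q_def)
  have fin: "finite ?A" using assms by (intro finite_roots_unity) auto
  have degP: "degree P = n"
    unfolding P_def by (subst degree_prod_eq_sum_degree) (use assms card_roots_unity_eq in auto)
  have lcP: "lead_coeff P = 1"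
    unfolding P_def by (simp add: lead_coeff_prod)
  have "degree (P - Q) < n"
  proof (rule degree_lessI)
    show "P - Q \<noteq> 0 \<or> n > 0" using assms by simp
    show "\<forall>k\<ge>n. coeff (P - Q) k = 0"
    proof (intro allI impI)
      fix k assume "k \<ge> n"
      show "coeff (P - Q) k = 0"
      proof (cases "k = n")
        case True
        thus ?thesis using lcP degP assms by (simp add: Q_def)
      next
        case False
        hence "k > n" using \<open>k \<ge> n\<close> by simp
        thus ?thesis using degP assms by (simp add: Q_def coeff_eq_0)
      qed
    qed
  qed
  moreover have "?A \<subseteq> {z. poly (P - Q) z = 0}"
    using fin by (auto simp: P_def Q_def poly_prod poly_monom intro: prod_zero)
  hence "card ?A \<le> degree (P - Q)"
    using card_mono[OF poly_roots_finite[OF neq]] card_poly_roots_bound[OF neq]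
    by (meson order_trans)
  ultimately show False using card_roots_unity_eq[OF assms] by simp
qed

lemma prod_prod_primitive_roots_unity:
  assumes "n > 0"
  shows "(\<Prod>d | d dvd n. \<Prod>z\<in>primitive_roots_unity d. [:- z, 1:]) = monom 1 n - 1"
proof -
  have "(\<Prod>z | z ^ n = 1. [:- z, 1:]) = (\<Prod>d | d dvd n. \<Prod>z\<in>primitive_roots_unity d. [:- z, 1::complex:])"
    unfolding roots_unity_eq_Union_primitive[OF assms] using assms
    by (intro prod.UNION_disjoint ballI impI finite_primitive_roots_unity
        primitive_roots_unity_disjoint) (auto intro: dvd_pos_nat)
  thus ?thesis using prod_roots_unity[OF assms] by simp
qed

lemma map_poly_of_rat_mult:
  "map_poly of_rat (p * q) = (map_poly of_rat p * map_poly of_rat q :: complex poly)"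
  by (intro poly_eqI) (simp add: coeff_map_poly coeff_mult of_rat_sum of_rat_mult)

lemma map_poly_of_rat_add:
  "map_poly of_rat (p + q) = (map_poly of_rat p + map_poly of_rat q :: complex poly)"
  by (intro poly_eqI) (simp add: coeff_map_poly of_rat_add)

lemma map_poly_of_rat_eq_iff:
  "map_poly of_rat p = (map_poly of_rat q :: complex poly) \<longleftrightarrow> p = q"
  by (auto simp: poly_eq_iff coeff_map_poly)

lemma map_poly_of_rat_prod:
  "map_poly of_rat (\<Prod>i\<in>A. f i) = (\<Prod>i\<in>A. map_poly of_rat (f i) :: complex poly)"
  by (induction A rule: infinite_finite_induct) (auto simp: map_poly_of_rat_mult)

lemma rational_factor:
  fixes B :: "rat poly" and c :: "complex poly"
  assumes eq: "map_poly of_rat A = map_poly of_rat B * c" and "B \<noteq> 0"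
  shows "\<exists>p. map_poly of_rat p = c"
proof -
  define i where "i = (map_poly of_rat :: rat poly \<Rightarrow> complex poly)"
  have i0: "i p = 0 \<longleftrightarrow> p = 0" for p
    unfolding i_def by (simp add: map_poly_eq_0_iff)
  have deg: "degree (i p) = degree p" for p
    unfolding i_def by (simp add: degree_map_poly)
  have "i B * c = i (B * (A div B) + A mod B)" using eq by (simp add: i_def)
  hence "i B * c = i B * i (A div B) + i (A mod B)"
    unfolding i_def map_poly_of_rat_mult map_poly_of_rat_add .
  hence *: "i B * (c - i (A div B)) = i (A mod B)" by (simp add: algebra_simps)
  have "c - i (A div B) = 0"
  proof (rule ccontr)
    assume nz: "c - i (A div B) \<noteq> 0"
    with * i0 \<open>B \<noteq> 0\<close> have "A mod B \<noteq> 0" by (metis mult_eq_0_iff)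
    hence "degree (A mod B) < degree B" using \<open>B \<noteq> 0\<close> degree_mod_less' by blast
    moreover have "degree (i (A mod B)) = degree (i B) + degree (c - i (A div B))"
      using degree_mult_eq[of "i B" "c - i (A div B)"] * nz i0 \<open>B \<noteq> 0\<close> by simp
    ultimately show False by (simp add: deg)
  qed
  thus ?thesis unfolding i_def by auto
qed

lemma map_poly_cyclotomic:
  assumes "n > 0"
  shows "map_poly of_rat (cyclotomic n) = (\<Prod>z\<in>primitive_roots_unity n. [:- z, 1:])"
proof -
  let ?c = "\<lambda>n. \<Prod>z\<in>primitive_roots_unity n. [:- z, 1::complex:]"
  have "\<exists>p. map_poly of_rat p = ?c n"
    using assms
  proof (induction n rule: less_induct)
    case (less n)
    define D where "D = {d. d dvd n} - {n}"
    have fin: "finite {d. d dvd n}" using less.prems by simp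
    have i: "map_poly of_rat (monom 1 n - 1) = (monom 1 n - 1 :: complex poly)"
      by (intro poly_eqI) (simp add: coeff_map_poly of_rat_diff)
    have "\<exists>p. map_poly of_rat p = ?c d" if "d \<in> D" for d
      using that less.prems by (intro less.IH) (auto simp: D_def dvd_pos_nat dest: dvd_imp_le)
    then obtain p where p: "map_poly of_rat (p d) = ?c d" if "d \<in> D" for d by metis
    have "monom 1 n - 1 = ?c n * (\<Prod>d\<in>D. ?c d)"
      using prod_prod_primitive_roots_unity[OF less.prems] prod.remove[OF fin, of n ?c]
      by (simp add: D_def)
    also have "(\<Prod>d\<in>D. ?c d) = map_poly of_rat (\<Prod>d\<in>D. p d)"
      using p by (simp add: map_poly_of_rat_prod)
    finally have "map_poly of_rat (monom 1 n - 1) = map_poly of_rat (\<Prod>d\<in>D. p d) * ?c n"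
      by (simp add: i mult.commute)
    moreover have "(\<Prod>d\<in>D. p d) \<noteq> 0"
    proof
      assume "(\<Prod>d\<in>D. p d) = 0"
      then obtain d where d: "d \<in> D" "p d = 0" using fin by (auto simp: D_def)
      moreover have "finite (primitive_roots_unity d)"
        using d less.prems by (intro finite_primitive_roots_unity) (auto simp: D_def dvd_pos_nat)
      ultimately show False using p[of d] by (auto dest!: sym[of 0])
    qed
    ultimately show ?case by (rule rational_factor)
  qed
  then obtain p where p: "map_poly of_rat p = ?c n" ..
  show ?thesis
    unfolding cyclotomic_def
  proof (rule theI[of _ p])
    fix q assume "map_poly of_rat q = ?c n"
    hence "map_poly of_rat q = (map_poly of_rat p :: complex poly)" using p by simp
    thus "q = p" by (simp only: map_poly_of_rat_eq_iff)
  qed (fact p)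
qed

definition Phi :: "nat \<Rightarrow> rat poly" where
  "Phi n = (if n = 1 then [:1, - 1:] else cyclotomic n)"


section \<open>The operators and polynomials of the decomposition\<close>

text \<open>Meaningful for non-constant \<open>a\<close> and \<open>coprime s a\<close>, as in all uses below.\<close>
definition eval_mod :: "rat poly \<Rightarrow> rat poly \<Rightarrow> rat poly \<Rightarrow> rat poly" where
  "eval_mod r s a = (modular_inverse a s * r) mod a"

text \<open>Division is exact for \<open>k \<ge> 1\<close>.\<close>
definition Theta :: "nat \<Rightarrow> rat poly" where
  "Theta k = (1 - monom 1 k) div Phi k"

definition h_poly :: "nat \<Rightarrow> nat \<Rightarrow> rat poly" where
  "h_poly N k = eval_mod 1 (\<Prod>i\<in>{1..N} - {k}. Phi i ^ (N div i)) (Phi k ^ (N div k))"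

definition g_poly :: "nat \<Rightarrow> nat \<Rightarrow> rat poly" where
  "g_poly N k = Theta k ^ (N div k) * h_poly N k"

text \<open>For \<open>m < k\<close> the exponent \<open>m - k\<close> is truncated, but the coefficient \<open>m div k\<close> is 0.\<close>
definition D_op :: "nat \<Rightarrow> rat poly \<Rightarrow> rat poly" where
  "D_op k p = (\<Sum>m\<le>degree p. monom (of_nat (m div k) * coeff p m) (m - k))"

lemma D_op_altdef:
  assumes "degree p \<le> n"
  shows "D_op k p = (\<Sum>m\<le>n. monom (of_nat (m div k) * coeff p m) (m - k))"
  unfolding D_op_def using assms
  by (intro sum.mono_neutral_left) (auto simp: coeff_eq_0)

lemma D_op_monom: "D_op k (monom 1 m) = monom (of_nat (m div k)) (m - k)"
proof -
  have "D_op k (monom 1 m) =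
      (\<Sum>i\<le>m. if i = m then monom (of_nat (m div k)) (m - k) else 0)"
    unfolding D_op_def by (intro sum.cong) (auto simp: degree_monom_eq)
  thus ?thesis by simp
qed

lemma D_op_add: "D_op k (p + q) = D_op k p + D_op k q"
proof -
  define n where "n = max (degree p) (degree q)"
  have "degree p \<le> n" "degree q \<le> n" "degree (p + q) \<le> n"
    by (auto simp: n_def degree_add_le_max)
  thus ?thesis
    by (simp add: D_op_altdef[of _ n] sum.distrib algebra_simps flip: add_monom)
qed

lemma D_op_smult: "D_op k (smult c p) = smult c (D_op k p)"
  by (subst D_op_altdef[of _ "degree p"])
    (auto simp: degree_smult_le D_op_def poly_eq_iff coeff_sum sum_distrib_left intro!: sum.cong)

text \<open>
  The family is indexed from the top: for \<open>0 \<le> j < N div k\<close>, the polynomial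
  \<open>g_part N k (N div k - j)\<close> is \<open>(-1)^j / j! * D_k^j g_k\<close> reduced modulo \<open>1 - x^k\<close>.
\<close>
definition g_part :: "nat \<Rightarrow> nat \<Rightarrow> nat \<Rightarrow> rat poly" where
  "g_part N k l =
     (let j = N div k - l
      in eval_mod (smult ((- 1) ^ j / fact j) ((D_op k ^^ j) (g_poly N k))) 1 (1 - monom 1 k))"

end

theory Submission
  imports Defs
begin

text \<open>
  Grouping the factors of \<open>1 - x^k\<close> gives \<open>\<Prod>k\<le>N. 1 - x^k = \<Prod>i\<le>N. Phi i ^ (N div i)\<close>, with pairwise
  coprime \<open>Phi i\<close>, so by partial fractions the left-hand side is the sum over \<open>k\<close> of
  \<open>h_k / Phi k ^ (N div k) = g_k / (1 - x^k) ^ (N div k)\<close>. For each \<open>k\<close> write \<open>y = x^k\<close> and view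
  \<open>g_k\<close> as a polynomial in \<open>y\<close> whose coefficients are polynomials in \<open>x\<close> of degree below \<open>k\<close>.
  Then \<open>D_op k\<close> is \<open>d/dy\<close>, reduction modulo \<open>1 - x^k\<close> is evaluation at \<open>y = 1\<close>, and the \<open>g_part\<close>
  are the Taylor coefficients of \<open>g_k\<close> in powers of \<open>1 - y\<close>; the expansion stops before the
  power \<open>N div k\<close> because \<open>degree g_k < (N div k) * k\<close>.
\<close>

section \<open>Factorisation of \<open>1 - x^n\<close> into pairwise coprime
  \<open>Phi d\<close>\<close>

lemma prod_cyclotomic:
  assumes "n > 0"
  shows "(\<Prod>d | d dvd n. cyclotomic d) = monom 1 n - 1"
proof -
  have "map_poly of_rat (\<Prod>d | d dvd n. cyclotomic d) =
      (\<Prod>d | d dvd n. \<Prod>z\<in>primitive_roots_unity d. [:- z, 1::complex:])"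
    unfolding map_poly_of_rat_prod using assms
    by (intro prod.cong refl map_poly_cyclotomic) (auto intro: dvd_pos_nat)
  also have "\<dots> = monom 1 n - 1"
    using assms by (rule prod_prod_primitive_roots_unity)
  also have "\<dots> = map_poly of_rat (monom 1 n - 1)"
    by (intro poly_eqI) (simp add: coeff_map_poly of_rat_diff)
  finally show ?thesis by (simp only: map_poly_of_rat_eq_iff)
qed

text \<open>\<open>Phi\<close> and \<open>cyclotomic\<close> differ only at index 1, by a sign;
  since 1 divides every \<open>n\<close>, exactly one sign flips.\<close>

lemma prod_Phi:
  assumes "n > 0"
  shows "(\<Prod>d | d dvd n. Phi d) = 1 - monom 1 n"
proof -
  have fin: "finite {d. d dvd n}" and one: "1 \<in> {d. d dvd n}" using assms by auto
  have "cyclotomic 1 = monom 1 1 - 1"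
    using prod_cyclotomic[of 1] by simp
  hence "Phi 1 = - cyclotomic 1"
    by (simp add: Phi_def monom_altdef one_pCons)
  moreover have "(\<Prod>d\<in>{d. d dvd n} - {1}. Phi d) = (\<Prod>d\<in>{d. d dvd n} - {1}. cyclotomic d)"
    by (intro prod.cong) (auto simp: Phi_def)
  ultimately have "(\<Prod>d | d dvd n. Phi d) = - (\<Prod>d | d dvd n. cyclotomic d)"
    by (simp add: prod.remove[OF fin one])
  thus ?thesis using prod_cyclotomic[OF assms] by simp
qed

lemma Phi_dvd: "n > 0 \<Longrightarrow> d dvd n \<Longrightarrow> Phi d dvd 1 - monom 1 n"
  by (subst prod_Phi[symmetric]) (auto intro!: dvd_prodI)

lemma Phi_mult_dvd:
  assumes "n > 0" "i dvd n" "j dvd n" "i \<noteq> j"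
  shows "Phi i * Phi j dvd 1 - monom 1 n"
proof -
  have "(\<Prod>d\<in>{i, j}. Phi d) dvd (\<Prod>d | d dvd n. Phi d)"
    using assms by (intro prod_dvd_prod_subset) auto
  thus ?thesis using assms by (simp add: prod_Phi)
qed

lemma one_minus_monom_neq_0: "k > 0 \<Longrightarrow> 1 - monom (1 :: 'a :: comm_ring_1) k \<noteq> 0"
  by (auto simp: poly_eq_iff dest!: spec[of _ 0])

lemma degree_one_minus_monom: "degree (1 - monom (1 :: 'a :: comm_ring_1) k) = k"
proof (cases "k = 0")
  case False
  have "degree (- monom (1 :: 'a) k + 1) = degree (- monom (1 :: 'a) k)"
    using False by (intro degree_add_eq_left) (simp add: degree_monom_eq)
  thus ?thesis by (simp add: degree_monom_eq)
qed simp

lemma coprime_Phi: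
  assumes "i > 0" "j > 0" "i \<noteq> j"
  shows "coprime (Phi i) (Phi j)"
proof (rule coprimeI)
  \<comment> \<open>The product divides the squarefree polynomial \<open>1 - x^(i*j)\<close>.\<close>
  fix q assume "q dvd Phi i" "q dvd Phi j"
  define n where "n = i * j"
  define P where "P = 1 - monom (1 :: rat) n"
  have n: "n > 0" using assms by (simp add: n_def)
  have "q * q dvd Phi i * Phi j"
    using \<open>q dvd Phi i\<close> \<open>q dvd Phi j\<close> by (rule mult_dvd_mono)
  also have "\<dots> dvd P"
    unfolding P_def using assms by (intro Phi_mult_dvd n) (auto simp: n_def)
  finally obtain r where r: "P = q * q * r" ..
  hence "pderiv P = q * (pderiv q * r + pderiv q * r + q * pderiv r)"
    by (simp add: pderiv_mult algebra_simps)
  \<comment> \<open>\<open>x * P' = - n * x^n\<close>, so this combination cancels the leading term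
    of \<open>n * P\<close> and leaves the nonzero constant \<open>n\<close>.\<close>
  hence "q dvd smult (of_nat n) P - monom 1 1 * pderiv P"
    using r by (intro dvd_diff dvd_smult dvd_mult) auto
  also have "smult (of_nat n) P - monom 1 1 * pderiv P = [:of_nat n:]"
    using n by (simp add: P_def pderiv_diff pderiv_monom mult_monom smult_diff_right
        smult_monom one_pCons)
  finally have "q dvd [:of_nat n:]" .
  moreover have "is_unit [:of_nat n :: rat:]"
    using n by (simp add: is_unit_const_poly_iff dvd_field_iff)
  ultimately show "is_unit q" by (rule dvd_unit_imp_unit)
qed

lemma card_multiples_atMost:
  assumes "d > 0"
  shows "card {k \<in> {1..N}. d dvd k} = N div d"
proof -
  have "bij_betw (\<lambda>m. d * m) {1..N div d} {k \<in> {1..N}. d dvd k}"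
    using assms
    by (intro bij_betwI[of _ _ _ "\<lambda>k. k div d"])
      (auto simp: less_eq_div_iff_mult_less_eq mult.commute div_le_mono elim!: dvdE)
  thus ?thesis using bij_betw_same_card by fastforce
qed

text \<open>After swapping the two products, \<open>Phi d\<close> is collected once for each
  multiple of \<open>d\<close> up to \<open>N\<close>.\<close>

lemma prod_one_minus_monom:
  "(\<Prod>k = 1..N. 1 - monom 1 k) = (\<Prod>i = 1..N. Phi i ^ (N div i))"
proof -
  have "(\<Prod>k = 1..N. 1 - monom 1 k) = (\<Prod>k = 1..N. \<Prod>d | d \<in> {1..N} \<and> d dvd k. Phi d)"
  proof (intro prod.cong refl)
    fix k assume "k \<in> {1..N}"
    hence "{d. d dvd k} = {d. d \<in> {1..N} \<and> d dvd k}"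
      by (auto dest: dvd_imp_le intro: Suc_leI dvd_pos_nat)
    thus "1 - monom 1 k = (\<Prod>d | d \<in> {1..N} \<and> d dvd k. Phi d)"
      using \<open>k \<in> {1..N}\<close> by (simp flip: prod_Phi)
  qed
  also have "\<dots> = (\<Prod>d = 1..N. \<Prod>k | k \<in> {1..N} \<and> d dvd k. Phi d)"
    by (rule prod.swap_restrict) auto
  also have "\<dots> = (\<Prod>i = 1..N. Phi i ^ (N div i))"
    using card_multiples_atMost by (intro prod.cong refl) simp
  finally show ?thesis .
qed

section \<open>Partial fractions over pairwise coprime moduli\<close>

lemma prod_dvd_of_pairwise_coprime:
  fixes a :: "'a :: semiring_gcd"
  assumes "finite I" "\<And>i. i \<in> I \<Longrightarrow> Q i dvd a"
    and "\<And>i j. i \<in> I \<Longrightarrow> j \<in> I \<Longrightarrow> i \<noteq> j \<Longrightarrow> coprime (Q i) (Q j)"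
  shows "prod Q I dvd a"
  using assms
proof (induction I rule: finite_induct)
  case (insert i I)
  hence "coprime (Q i) (prod Q I)"
    by (intro prod_coprime_right) auto
  with insert show ?case by (auto intro!: divides_mult)
qed simp

text \<open>Coprimality makes \<open>modular_inverse a s\<close> a true inverse of \<open>s\<close>.
  With the degree bound below, this is all that partial fractions need from
  \<open>eval_mod\<close>.\<close>

lemma eval_mod_cong:
  assumes "coprime s a"
  shows "[eval_mod r s a * s = r] (mod a)"
proof -
  have "[eval_mod r s a * s = modular_inverse a s * s * r] (mod a)"
    unfolding eval_mod_def cong_def mod_mult_left_eq by (simp only: mult_ac)
  also have "[modular_inverse a s * s * r = 1 * r] (mod a)"
    by (intro cong_mult cong_modular_inverse2 assms cong_refl)
  finally show ?thesis by simp
qed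

lemma eval_mod_1 [simp]: "eval_mod r 1 a = r mod a"
  using eval_mod_cong[of 1 a r] by (simp add: cong_def eval_mod_def)

lemma degree_eval_mod:
  "a \<noteq> 0 \<Longrightarrow> eval_mod r s a = 0 \<or> degree (eval_mod r s a) < degree a"
  unfolding eval_mod_def by (rule degree_mod_less)

text \<open>The difference of the two sides is divisible by every \<open>Q i\<close>, hence by their product,
  whose degree exceeds that of the difference.\<close>
lemma partial_fractions_eval_mod:
  assumes "finite I" and deg: "degree (prod Q I) > 0"
    and cop: "\<And>i j. i \<in> I \<Longrightarrow> j \<in> I \<Longrightarrow> i \<noteq> j \<Longrightarrow> coprime (Q i) (Q j)"
  shows "(\<Sum>i\<in>I. eval_mod 1 (prod Q (I - {i})) (Q i) * prod Q (I - {i})) = 1"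
    (is "sum ?t I = 1")
proof (rule ccontr)
  let ?S = "sum ?t I"
  assume "?S \<noteq> 1"
  have nz: "prod Q I \<noteq> 0" using deg by auto
  have "prod Q I dvd ?S - 1"
  proof (rule prod_dvd_of_pairwise_coprime)
    fix i assume i: "i \<in> I"
    \<comment> \<open>Modulo \<open>Q i\<close> the summands with \<open>j \<noteq> i\<close>
      vanish, since they contain the factor \<open>Q i\<close>, and the \<open>i\<close>-th is
      1.\<close>
    have "Q i dvd ?t j" if "j \<in> I - {i}" for j
      using that i \<open>finite I\<close> by (intro dvd_mult dvd_prodI) auto
    hence "Q i dvd (\<Sum>j\<in>I - {i}. ?t j)" by (rule dvd_sum)
    moreover have "Q i dvd ?t i - 1"
    proof -
      have "coprime (prod Q (I - {i})) (Q i)"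
        using i cop by (intro prod_coprime_left) auto
      from eval_mod_cong[OF this] show ?thesis by (simp add: cong_iff_dvd_diff)
    qed
    ultimately have "Q i dvd (?t i - 1) + (\<Sum>j\<in>I - {i}. ?t j)" by (intro dvd_add)
    thus "Q i dvd ?S - 1"
      using i \<open>finite I\<close> by (simp add: sum.remove algebra_simps)
  qed (use assms in auto)
  hence "degree (prod Q I) \<le> degree (?S - 1)"
    using \<open>?S \<noteq> 1\<close> by (intro dvd_imp_degree_le) auto
  moreover have "degree (?S - 1) < degree (prod Q I)"
  proof (intro degree_diff_less degree_sum_less)
    fix i assume i: "i \<in> I"
    have prod: "prod Q I = Q i * prod Q (I - {i})"
      using i \<open>finite I\<close> by (simp add: prod.remove)
    with nz have "Q i \<noteq> 0" "prod Q (I - {i}) \<noteq> 0" by auto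
    \<comment> \<open>If the remainder is zero, the summand has degree 0 and the bound comes from
      \<open>deg\<close>.\<close>
    with degree_eval_mod[of "Q i" 1 "prod Q (I - {i})"] deg
    show "degree (?t i) < degree (prod Q I)"
      unfolding prod
      by (auto simp: degree_mult_eq intro: le_less_trans[OF degree_mult_le] add_strict_right_mono)
  qed (use deg in auto)
  ultimately show False by simp
qed

section \<open>Taylor expansion in powers of \<open>1 - x^k\<close>\<close>

lemma funpow_D_op_add: "(D_op k ^^ j) (p + q) = (D_op k ^^ j) p + (D_op k ^^ j) q"
  by (induction j) (auto simp: D_op_add)

lemma funpow_D_op_smult: "(D_op k ^^ j) (smult c p) = smult c ((D_op k ^^ j) p)"
  by (induction j) (auto simp: D_op_smult)

text \<open>With \<open>y = x^k\<close>, this is the \<open>j\<close>-th derivative of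
  \<open>y^q\<close>; since \<open>r < k\<close>, the factor \<open>x^r\<close> acts as a constant.
  For \<open>j > q\<close> the binomial coefficient is 0, so the truncated exponent is
  harmless.\<close>

lemma funpow_D_op_monom:
  assumes "r < k"
  shows "(D_op k ^^ j) (monom 1 (q * k + r)) =
    monom (fact j * of_nat (q choose j)) ((q - j) * k + r)"
proof (induction j)
  case (Suc j)
  have "D_op k (monom c ((q - j) * k + r)) =
      monom (c * of_nat (q - j)) ((q - Suc j) * k + r)" for c
  proof -
    have "((q - j) * k + r) div k = q - j" using assms by simp
    \<comment> \<open>For \<open>j \<ge> q\<close> the exponents may disagree, but the coefficient
      \<open>q - j\<close> is then 0.\<close>
    moreover have "(q - j) * k + r - k = (q - Suc j) * k + r" if "j < q"
      using that by (simp add: algebra_simps diff_mult_distrib Suc_diff_Suc[symmetric])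
    ultimately have "D_op k (monom 1 ((q - j) * k + r)) =
        monom (of_nat (q - j)) ((q - Suc j) * k + r)"
      by (cases "j < q") (simp_all add: D_op_monom)
    thus ?thesis using D_op_smult[of k c "monom 1 ((q - j) * k + r)"]
      by (simp add: smult_monom)
  qed
  moreover have "fact j * of_nat (q choose j) * of_nat (q - j) =
      (fact (Suc j) * of_nat (q choose Suc j) :: rat)"
  proof -
    have "Suc j * (q choose Suc j) = (q - j) * (q choose j)"
      by (simp only: binomial_absorption binomial_absorb_comp)
    hence "of_nat (Suc j) * of_nat (q choose Suc j) = (of_nat (q - j) * of_nat (q choose j) :: rat)"
      by (simp only: flip: of_nat_mult)
    thus ?thesis by (simp only: fact_Suc mult_ac)
  qed
  ultimately show ?case using Suc by simp
qed simp

text \<open>\<open>x^k\<close> is congruent to 1, and \<open>r < k\<close> makes \<open>x^r\<close>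
  already reduced.\<close>

lemma monom_mod_one_minus_monom:
  assumes "r < k"
  shows "monom c (m * k + r) mod (1 - monom (1::rat) k) = monom c r"
proof -
  have "[monom 1 k = 1] (mod (1 - monom (1::rat) k))"
    by (simp add: cong_iff_dvd_diff dvd_diff_commute)
  hence "[monom 1 k ^ m * monom c r = 1 ^ m * monom c r] (mod (1 - monom (1::rat) k))"
    by (intro cong_mult cong_pow cong_refl)
  hence "[monom c (m * k + r) = monom c r] (mod (1 - monom (1::rat) k))"
    by (simp add: monom_power mult_monom mult.commute add.commute)
  moreover have "degree (monom c r) < degree (1 - monom (1::rat) k)"
    using degree_monom_le[of c r] assms by (simp add: degree_one_minus_monom)
  ultimately show ?thesis by (simp add: cong_def mod_poly_less)
qed

text \<open>Taking \<open>p\<close> arbitrary, not just \<open>g_poly N k\<close>, lets linearity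
  reduce the expansion to monomials. The sign \<open>(-1)^j\<close> appears because the powers are
  of \<open>1 - y\<close>, not \<open>y - 1\<close>.\<close>

definition taylor :: "nat \<Rightarrow> nat \<Rightarrow> rat poly \<Rightarrow> rat poly" where
  "taylor k n p = (\<Sum>j<n. smult ((- 1) ^ j / fact j) ((D_op k ^^ j) p) mod (1 - monom 1 k) *
     (1 - monom 1 k) ^ j)"

lemma taylor_add: "taylor k n (p + q) = taylor k n p + taylor k n q"
  by (simp add: taylor_def funpow_D_op_add smult_add_right poly_mod_add_left
      distrib_right sum.distrib)

lemma taylor_smult: "taylor k n (smult c p) = smult c (taylor k n p)"
  unfolding taylor_def
  by (induction n) (simp_all add: funpow_D_op_smult mod_smult_left smult_add_right mult.commute)

text \<open>For \<open>m = q * k + r\<close> this is \<open>x^r\<close> times the binomial expansion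
  of \<open>y^q = (1 - (1 - y))^q\<close>.\<close>

lemma taylor_monom:
  assumes "m < n * k"
  shows "taylor k n (monom 1 m) = monom 1 m"
proof -
  define q r where "q = m div k" and "r = m mod k"
  have "k > 0" using assms by (cases k) auto
  have m: "m = q * k + r" and r: "r < k" and q: "q < n"
    using assms \<open>k > 0\<close> by (auto simp: q_def r_def less_mult_imp_div_less)
  define Y where "Y = 1 - monom (1::rat) k"
  have "taylor k n (monom 1 m) =
      (\<Sum>j<n. monom 1 r * (of_nat (q choose j) * (- Y) ^ j))"
    unfolding taylor_def
  proof (intro sum.cong refl)
    fix j
    have "smult ((- 1) ^ j / fact j) ((D_op k ^^ j) (monom 1 m)) =
        monom ((- 1) ^ j * of_nat (q choose j)) ((q - j) * k + r)"
      by (simp add: m funpow_D_op_monom[OF r] smult_monom)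
    hence "smult ((- 1) ^ j / fact j) ((D_op k ^^ j) (monom 1 m)) mod (1 - monom 1 k) =
        monom ((- 1) ^ j * of_nat (q choose j)) r"
      by (simp only: monom_mod_one_minus_monom[OF r])
    also have "\<dots> = monom 1 r * of_nat (q choose j) * (- 1) ^ j"
      by (cases "even j") (simp_all add: of_nat_poly smult_monom minus_monom)
    finally show "smult ((- 1) ^ j / fact j) ((D_op k ^^ j) (monom 1 m)) mod (1 - monom 1 k) *
        (1 - monom 1 k) ^ j = monom 1 r * (of_nat (q choose j) * (- Y) ^ j)"
      by (simp add: Y_def[symmetric] power_minus[of Y] mult_ac)
  qed
  also have "\<dots> = monom 1 r * (\<Sum>j<n. of_nat (q choose j) * (- Y) ^ j)"
    by (simp add: sum_distrib_left)
  \<comment> \<open>\<open>m < n * k\<close> gives \<open>q < n\<close>, so no binomial term is cut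
    off; those with \<open>j > q\<close> are zero.\<close>
  also have "(\<Sum>j<n. of_nat (q choose j) * (- Y) ^ j) = (\<Sum>j\<le>q. of_nat (q choose j) * (- Y) ^ j)"
    using q by (intro sum.mono_neutral_right) (auto simp: binomial_eq_0)
  also have "\<dots> = (- Y + 1) ^ q"
    using binomial_ring[of "- Y" 1 q] by simp
  also have "monom 1 r * \<dots> = monom 1 m"
    by (simp add: Y_def monom_power mult_monom m ac_simps)
  finally show ?thesis .
qed

lemma taylor_eq:
  assumes "degree p < n * k"
  shows "taylor k n p = p"
proof -
  have "taylor k n (\<Sum>m\<in>A. monom (coeff p m) m) = (\<Sum>m\<in>A. monom (coeff p m) m)"
    if "finite A" "\<And>m. m \<in> A \<Longrightarrow> m < n * k" for A
    using that
  proof (induction A rule: finite_induct)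
    case empty
    show ?case using taylor_smult[of k n 0 0] by simp
  next
    case (insert m A)
    have "taylor k n (smult (coeff p m) (monom 1 m)) = smult (coeff p m) (monom 1 m)"
      using insert.prems by (simp only: taylor_smult taylor_monom insertI1)
    with insert show ?case by (simp add: taylor_add smult_monom)
  qed
  from this[of "{..degree p}"] assms show ?thesis
    by (simp add: poly_as_sum_of_monoms)
qed

section \<open>Degree bound for \<open>g_poly\<close> and assembly in the fraction field\<close>

lemma Theta_mult_Phi: "k > 0 \<Longrightarrow> Theta k * Phi k = 1 - monom 1 k"
  by (simp add: Theta_def Phi_dvd)

text \<open>\<open>h_poly N k\<close> is a remainder modulo \<open>Phi k ^ (N div k)\<close>, and
  \<open>Theta k * Phi k\<close> has degree \<open>k\<close>. The bound is what
  \<open>taylor_eq\<close> requires.\<close>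

lemma degree_g_poly:
  assumes "1 \<le> k" "k \<le> N"
  shows "degree (g_poly N k) < (N div k) * k"
proof -
  let ?n = "N div k"
  have TP: "Theta k * Phi k = 1 - monom 1 k" using assms by (intro Theta_mult_Phi) simp
  hence nz: "Theta k \<noteq> 0" "Phi k \<noteq> 0"
    using one_minus_monom_neq_0[of k, where 'a = rat] assms by auto
  have n: "?n > 0" using assms by (simp add: div_greater_zero_iff)
  have "degree (Theta k ^ ?n * Phi k ^ ?n) = ?n * k"
    using assms one_minus_monom_neq_0[of k, where 'a = rat]
    by (simp add: TP degree_power_eq degree_one_minus_monom flip: power_mult_distrib)
  moreover have "h_poly N k = 0 \<or> degree (h_poly N k) < degree (Phi k ^ ?n)"
    unfolding h_poly_def using nz by (intro degree_eval_mod) simp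
  ultimately show ?thesis
    using nz n assms
    by (auto simp: g_poly_def degree_mult_eq intro: le_less_trans[OF degree_mult_le])
qed

lemma to_fract_prod: "to_fract (prod f A) = (\<Prod>x\<in>A. to_fract (f x))"
  by (induction A rule: infinite_finite_induct) auto

lemma to_fract_power: "to_fract (p ^ n) = to_fract p ^ n"
  by (induction n) auto

lemma sum_g_part:
  assumes "1 \<le> k" "k \<le> N"
  shows "(\<Sum>l = 1..N div k. to_fract (g_part N k l) / to_fract (1 - monom 1 k) ^ l) =
    to_fract (g_poly N k) / to_fract (1 - monom 1 k) ^ (N div k)"
proof -
  let ?n = "N div k" and ?Y = "to_fract (1 - monom 1 k :: rat poly)"
  have Y: "?Y \<noteq> 0" using assms one_minus_monom_neq_0[of k, where 'a = rat]
    by (simp del: to_fract_diff)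
  \<comment> \<open>\<open>g_part\<close> is indexed from the top: \<open>l = ?n - j\<close> carries
    the \<open>j\<close>-th derivative, and the common denominator \<open>?Y ^ ?n\<close> supplies
    the Taylor factor \<open>(1 - x^k)^j\<close>.\<close>
  have "(\<Sum>l = 1..?n. to_fract (g_part N k l) / ?Y ^ l) =
      (\<Sum>j<?n. to_fract (g_part N k (?n - j)) / ?Y ^ (?n - j))"
    by (intro sum.reindex_bij_witness[of _ "\<lambda>j. ?n - j" "\<lambda>l. ?n - l"]) auto
  also have "\<dots> = (\<Sum>j<?n. to_fract (g_part N k (?n - j) * (1 - monom 1 k) ^ j) / ?Y ^ ?n)"
  proof (intro sum.cong refl)
    fix j assume "j \<in> {..<?n}"
    thus "to_fract (g_part N k (?n - j)) / ?Y ^ (?n - j) =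
        to_fract (g_part N k (?n - j) * (1 - monom 1 k) ^ j) / ?Y ^ ?n"
      using Y by (simp add: to_fract_power power_diff del: to_fract_diff)
  qed
  also have "\<dots> = to_fract (\<Sum>j<?n. g_part N k (?n - j) * (1 - monom 1 k) ^ j) / ?Y ^ ?n"
    by (simp add: sum_divide_distrib del: to_fract_mult)
  also have "(\<Sum>j<?n. g_part N k (?n - j) * (1 - monom 1 k) ^ j) = taylor k ?n (g_poly N k)"
    unfolding taylor_def by (intro sum.cong) (auto simp: g_part_def)
  also have "\<dots> = g_poly N k"
    using degree_g_poly[OF assms] by (rule taylor_eq)
  finally show ?thesis .
qed

theorem mainTheorem3:
  fixes N :: nat
  assumes "N \<ge> 1"
  shows "(\<Prod>k = 1..N. 1 / to_fract (1 - monom 1 k)) =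
         (\<Sum>k = 1..N. \<Sum>l = 1..N div k. to_fract (g_part N k l) / to_fract (1 - monom 1 k) ^ l)"
proof -
  let ?Q = "\<lambda>i. Phi i ^ (N div i)"
  define A where "A = prod ?Q {1..N}"
  have A: "A = (\<Prod>k = 1..N. 1 - monom 1 k)"
    by (simp only: A_def prod_one_minus_monom)
  have "A \<noteq> 0" using one_minus_monom_neq_0[where 'a = rat] by (auto simp: A)
  \<comment> \<open>A nonzero polynomial with a root is non-constant, as
    \<open>partial_fractions_eval_mod\<close> requires.\<close>
  have "poly A 1 = 0" using assms by (auto simp: A poly_prod poly_monom intro!: prod_zero)
  with \<open>A \<noteq> 0\<close> have degA: "degree A > 0"
    by (metis degree_eq_zeroE gr0I pCons_0_0 poly_const_conv)
  \<comment> \<open>Cancelling \<open>Theta k ^ (N div k)\<close> leaves \<open>h_poly N k\<close>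
    over \<open>?Q k\<close>, which is then expanded to the denominator \<open>A\<close>.\<close>
  have "to_fract (g_poly N k) / to_fract (1 - monom 1 k) ^ (N div k) =
      to_fract (h_poly N k * prod ?Q ({1..N} - {k})) / to_fract A" if k: "k \<in> {1..N}" for k
  proof -
    have "A = ?Q k * prod ?Q ({1..N} - {k})"
      unfolding A_def using k by (intro prod.remove) auto
    moreover have "(1 - monom 1 k) ^ (N div k) = Theta k ^ (N div k) * ?Q k"
      using k by (simp add: Theta_mult_Phi flip: power_mult_distrib)
    moreover have "Theta k ^ (N div k) \<noteq> 0"
      using k one_minus_monom_neq_0[of k, where 'a = rat] Theta_mult_Phi[of k]
      by (intro power_not_zero) auto
    ultimately show ?thesis
      using \<open>A \<noteq> 0\<close> unfolding to_fract_power[symmetric]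
      by (auto simp: g_poly_def divide_simps simp del: power_eq_0_iff)
  qed
  hence "(\<Sum>k = 1..N. \<Sum>l = 1..N div k. to_fract (g_part N k l) / to_fract (1 - monom 1 k) ^ l) =
      (\<Sum>k = 1..N. to_fract (h_poly N k * prod ?Q ({1..N} - {k})) / to_fract A)"
    by (intro sum.cong refl) (simp only: sum_g_part atLeastAtMost_iff)
  also have "\<dots> = to_fract (\<Sum>k = 1..N. h_poly N k * prod ?Q ({1..N} - {k})) / to_fract A"
    by (simp add: sum_divide_distrib del: to_fract_mult)
  also have "(\<Sum>k = 1..N. h_poly N k * prod ?Q ({1..N} - {k})) = 1"
    unfolding h_poly_def using degA
    by (intro partial_fractions_eval_mod) (auto simp: A_def intro!: coprime_Phi)
  also have "to_fract 1 / to_fract A = (\<Prod>k = 1..N. 1 / to_fract (1 - monom 1 k))"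
    by (simp only: A to_fract_prod prod_dividef to_fract_1 prod.neutral_const)
  finally show ?thesis ..
qed

end
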